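(* Let $\mathcal{Q}$ be a finite classical polar space of rank $r\ge 1$, type $Q$ and parameter $\epsilon$ over $\mathbb{F}_q$, let $0\le t\le k\le r$, and let $D$ be a $t$-$(r,k,\lambda)_Q$ design in $\mathcal{Q}$. Then for each $s\in\{0,\ldots,t\}$, $D$ is an $s$-$(r,k,\lambda_s)_Q$ design with $$\lambda_s=\lambda\cdot\frac{\begin{bmatrix} r-s\\ t-s\end{bmatrix}_Q}{\begin{bmatrix} k-s\\ t-s\end{bmatrix}_q}=\lambda\cdot\frac{\begin{bmatrix} r-s\\ t-s\end{bmatrix}_q}{\begin{bmatrix} k-s\\ t-s\end{bmatrix}_q}\cdot\prod_{i=r-t+1}^{r-s}(q^{i+\epsilon}+1).$$ In particular, the number of blocks of $D$ is $\#D=\lambda_0$.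
   Context: Let $q$ be a prime power. A finite classical polar space $\mathcal{Q}$ over $\mathbb{F}_q$ consists of all subspaces of a finite-dimensional $\mathbb{F}_q$-vector space $V$, $n=\dim V$, that are totally isotropic (resp. totally singular) with respect to a non-degenerate alternating or Hermitian form (resp. a non-singular quadratic form) on $V$. All dimensions are vector space dimensions. The rank $r$ is the maximal dimension of a subspace in $\mathcal{Q}$. The type $Q$ of $\mathcal{Q}$ (kind of form together with $q$) and its parameter $\epsilon$ are: symplectic $\mathrm{Sp}(q)$ ($n=2r$, $\epsilon=0$); Hermitian $U^+(q)$ ($q$ a square, $n=2r$, $\epsilon=-1/2$); Hermitian $U^-(q)$ ($q$ a square, $n=2r+1$, $\epsilon=1/2$); hyperbolic $\Omega^+(q)$ ($n=2r$, $\epsilon=-1$); parabolic $\Omega(q)$ ($n=2r+1$, $\epsilon=0$); elliptic $\Omega^-(q)$ ($n=2r+2$, $\epsilon=1$). $\begin{bmatrix} m\\ k\end{bmatrix}_q$ is the Gaussian binomial coefficient (number of $k$-dimensional subspaces of $\mathbb{F}_q^m$). $\begin{bmatrix} m\\ k\end{bmatrix}_Q=\begin{bmatrix} m\\ k\end{bmatrix}_q\prod_{i=m-k+1}^{m}(q^{i+\epsilon}+1)$ is the number of $k$-dimensional subspaces in a polar space of type $Q$ and rank $m$. For $t,k\in\{0,\ldots,r\}$ and an integer $\lambda\ge 0$, a $t$-$(r,k,\lambda)_Q$ design in $\mathcal{Q}$ is a set $D$ of $k$-dimensional subspaces of $\mathcal{Q}$ (called blocks) such that every $t$-dimensional subspace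 of $\mathcal{Q}$ is contained in exactly $\lambda$ elements of $D$. *)

theory Defs
  imports Complex_Main "HOL-Library.Cardinality"
begin

section \<open>Forms\<close>

definition bilinear_form :: "('a::field \<Rightarrow> 'v::ab_group_add \<Rightarrow> 'v) \<Rightarrow> ('v \<Rightarrow> 'v \<Rightarrow> 'a) \<Rightarrow> bool" where
  "bilinear_form scale B \<longleftrightarrow>
     (\<forall>y. Vector_Spaces.linear scale (*) (\<lambda>x. B x y)) \<and>
     (\<forall>x. Vector_Spaces.linear scale (*) (B x))"

definition alternating_form :: "('a::field \<Rightarrow> 'v::ab_group_add \<Rightarrow> 'v) \<Rightarrow> ('v \<Rightarrow> 'v \<Rightarrow> 'a) \<Rightarrow> bool" where
  "alternating_form scale B \<longleftrightarrow> bilinear_form scale B \<and> (\<forall>x. B x x = 0)"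

text \<open>Over a finite field whose order is a square \<open>q = p\<^sup>2\<close> (\<open>p\<close> is the square root of the
  order, not necessarily a prime), the involutory field automorphism is \<open>c \<mapsto> c ^ p\<close>.
  In particular, the order of the field is a square as soon as a Hermitian form exists.\<close>

definition hermitian_form :: "('a::{field,finite} \<Rightarrow> 'v::ab_group_add \<Rightarrow> 'v) \<Rightarrow> ('v \<Rightarrow> 'v \<Rightarrow> 'a) \<Rightarrow> bool" where
  "hermitian_form scale B \<longleftrightarrow>
     (\<exists>p. CARD('a) = p\<^sup>2 \<and>
        (\<forall>y. Vector_Spaces.linear scale (*) (\<lambda>x. B x y)) \<and>
        (\<forall>x y. B y x = B x y ^ p))"

definition nondegenerate :: "('v::zero \<Rightarrow> 'v \<Rightarrow> 'a::zero) \<Rightarrow> bool" where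
  "nondegenerate B \<longleftrightarrow> (\<forall>x. (\<forall>y. B x y = 0) \<longrightarrow> x = 0)"

definition polarization :: "('v::ab_group_add \<Rightarrow> 'a::ab_group_add) \<Rightarrow> 'v \<Rightarrow> 'v \<Rightarrow> 'a" where
  "polarization f x y = f (x + y) - f x - f y"

definition quadratic_form :: "('a::field \<Rightarrow> 'v::ab_group_add \<Rightarrow> 'v) \<Rightarrow> ('v \<Rightarrow> 'a) \<Rightarrow> bool" where
  "quadratic_form scale f \<longleftrightarrow>
     (\<forall>c x. f (scale c x) = c\<^sup>2 * f x) \<and> bilinear_form scale (polarization f)"

text \<open>In characteristic 2 and odd dimension the polarization of a non-singular quadratic form is
  degenerate, so only the singular vectors in its radical are required to vanish.\<close>

definition nonsingular :: "('v::ab_group_add \<Rightarrow> 'a::ab_group_add) \<Rightarrow> bool" where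
  "nonsingular f \<longleftrightarrow> (\<forall>x. f x = 0 \<and> (\<forall>y. polarization f x y = 0) \<longrightarrow> x = 0)"

definition isotropic_subspaces ::
  "('a::field \<Rightarrow> 'v::ab_group_add \<Rightarrow> 'v) \<Rightarrow> ('v \<Rightarrow> 'v \<Rightarrow> 'a) \<Rightarrow> 'v set set" where
  "isotropic_subspaces scale B =
     {U. module.subspace scale U \<and> (\<forall>x\<in>U. \<forall>y\<in>U. B x y = 0)}"

definition singular_subspaces ::
  "('a::field \<Rightarrow> 'v::ab_group_add \<Rightarrow> 'v) \<Rightarrow> ('v \<Rightarrow> 'a) \<Rightarrow> 'v set set" where
  "singular_subspaces scale f = {U. module.subspace scale U \<and> (\<forall>x\<in>U. f x = 0)}"


section \<open>Polar spaces\<close>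

datatype polar_type =
  Symplectic | Hermitian_Plus | Hermitian_Minus | Hyperbolic | Parabolic | Elliptic

fun polar_eps :: "polar_type \<Rightarrow> real" where
  "polar_eps Symplectic = 0"
| "polar_eps Hermitian_Plus = - 1 / 2"
| "polar_eps Hermitian_Minus = 1 / 2"
| "polar_eps Hyperbolic = - 1"
| "polar_eps Parabolic = 0"
| "polar_eps Elliptic = 1"

fun ambient_dim :: "polar_type \<Rightarrow> nat \<Rightarrow> nat" where
  "ambient_dim Symplectic r = 2 * r"
| "ambient_dim Hermitian_Plus r = 2 * r"
| "ambient_dim Hermitian_Minus r = 2 * r + 1"
| "ambient_dim Hyperbolic r = 2 * r"
| "ambient_dim Parabolic r = 2 * r + 1"
| "ambient_dim Elliptic r = 2 * r + 2"

fun subspaces_of_form_kind ::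
  "('a::{field,finite} \<Rightarrow> 'v::ab_group_add \<Rightarrow> 'v) \<Rightarrow> polar_type \<Rightarrow> 'v set set \<Rightarrow> bool" where
  "subspaces_of_form_kind scale Symplectic P \<longleftrightarrow>
     (\<exists>B. alternating_form scale B \<and> nondegenerate B \<and> P = isotropic_subspaces scale B)"
| "subspaces_of_form_kind scale Hermitian_Plus P \<longleftrightarrow>
     (\<exists>B. hermitian_form scale B \<and> nondegenerate B \<and> P = isotropic_subspaces scale B)"
| "subspaces_of_form_kind scale Hermitian_Minus P \<longleftrightarrow>
     (\<exists>B. hermitian_form scale B \<and> nondegenerate B \<and> P = isotropic_subspaces scale B)"
| "subspaces_of_form_kind scale Hyperbolic P \<longleftrightarrow>
     (\<exists>f. quadratic_form scale f \<and> nonsingular f \<and> P = singular_subspaces scale f)"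
| "subspaces_of_form_kind scale Parabolic P \<longleftrightarrow>
     (\<exists>f. quadratic_form scale f \<and> nonsingular f \<and> P = singular_subspaces scale f)"
| "subspaces_of_form_kind scale Elliptic P \<longleftrightarrow>
     (\<exists>f. quadratic_form scale f \<and> nonsingular f \<and> P = singular_subspaces scale f)"

definition polar_rank :: "('a::field \<Rightarrow> 'v::ab_group_add \<Rightarrow> 'v) \<Rightarrow> 'v set set \<Rightarrow> nat" where
  "polar_rank scale P = Max (vector_space.dim scale ` P)"

text \<open>The set \<open>P\<close> of subspaces of the finite-dimensional vector space \<open>'v\<close> is a polar space of
  type \<open>Q\<close> and rank \<open>r\<close>. Types sharing a kind of form are told apart by the dimension of the
  ambient space.\<close>

definition polar_space ::
  "('a::{field,finite} \<Rightarrow> 'v::ab_group_add \<Rightarrow> 'v) \<Rightarrow> polar_type \<Rightarrow> nat \<Rightarrow> 'v set set \<Rightarrow> bool" where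
  "polar_space scale Q r P \<longleftrightarrow>
     subspaces_of_form_kind scale Q P \<and>
     polar_rank scale P = r \<and>
     vector_space.dim scale (UNIV :: 'v set) = ambient_dim Q r"

definition polar_design ::
  "('a::field \<Rightarrow> 'v::ab_group_add \<Rightarrow> 'v) \<Rightarrow> 'v set set \<Rightarrow> nat \<Rightarrow> nat \<Rightarrow> nat \<Rightarrow> nat \<Rightarrow> 'v set set \<Rightarrow> bool" where
  "polar_design scale P t r k l D \<longleftrightarrow>
     polar_rank scale P = r \<and> t \<le> r \<and> k \<le> r \<and>
     D \<subseteq> {U \<in> P. vector_space.dim scale U = k} \<and>
     (\<forall>T\<in>P. vector_space.dim scale T = t \<longrightarrow> card {U \<in> D. T \<subseteq> U} = l)"


section \<open>Gaussian binomial coefficients\<close>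

text \<open>For \<open>k > m\<close> the factor with \<open>i = m\<close> vanishes. See \<open>card_subspaces_of_dim\<close> below for
  the combinatorial meaning.\<close>

definition gauss_binomial :: "nat \<Rightarrow> nat \<Rightarrow> nat \<Rightarrow> real" where
  "gauss_binomial q m k = (\<Prod>i<k. (real q ^ (m - i) - 1) / (real q ^ (k - i) - 1))"

definition polar_binomial :: "polar_type \<Rightarrow> nat \<Rightarrow> nat \<Rightarrow> nat \<Rightarrow> real" where
  "polar_binomial Q q m k =
     gauss_binomial q m k * (\<Prod>i = m - k + 1..m. real q powr (real i + polar_eps Q) + 1)"

lemma card_span_independent:
  fixes scale :: "'a::{field,finite} \<Rightarrow> 'v::ab_group_add \<Rightarrow> 'v"
  assumes vs: "vector_space scale" and "finite S" and "\<not> module.dependent scale S"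
  shows "card (module.span scale S) = CARD('a) ^ card S \<and> finite (module.span scale S)"
proof -
  interpret vector_space scale by (rule vs)
  show ?thesis using assms(2,3)
  proof (induction S rule: finite_induct)
    case empty
    then show ?case by simp
  next
    case (insert a S)
    have ind: "independent S" and a: "a \<notin> span S"
      using insert.prems insert.hyps independent_insert by auto
    let ?g = "\<lambda>(c, v). scale c a + v"
    have bij: "bij_betw ?g (UNIV \<times> span S) (span (insert a S))"
    proof (rule bij_betwI')
      fix x y :: "'a \<times> 'v" assume xy: "x \<in> UNIV \<times> span S" "y \<in> UNIV \<times> span S"
      obtain c v d w where e: "x = (c, v)" "y = (d, w)" by (metis surj_pair)
      show "(?g x = ?g y) = (x = y)"
      proof
        assume h: "?g x = ?g y"
        then have h': "scale (c - d) a = w - v"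
          using e by (simp add: scale_left_diff_distrib algebra_simps)
        have wv: "w - v \<in> span S" using xy e by (auto intro: span_diff)
        have "c = d"
        proof (rule ccontr)
          assume "c \<noteq> d"
          then have "a = scale (inverse (c - d)) (scale (c - d) a)" by simp
          also have "\<dots> \<in> span S" unfolding h' using wv by (rule span_scale)
          finally show False using a by simp
        qed
        then show "x = y" using h e by simp
      qed simp
    next
      fix x :: "'a \<times> 'v" assume "x \<in> UNIV \<times> span S"
      then show "?g x \<in> span (insert a S)"
        by (auto simp: span_breakdown_eq[of _ a S] algebra_simps intro!: exI[of _ "fst x"])
    next
      fix y assume "y \<in> span (insert a S)"
      then obtain c where "y - scale c a \<in> span S" by (auto simp: span_breakdown_eq)
      then show "\<exists>x\<in>UNIV \<times> span S. y = ?g x"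
        by (intro bexI[of _ "(c, y - scale c a)"]) auto
    qed
    then show ?case
      using insert.IH[OF ind] insert.hyps bij_betw_same_card[OF bij] bij_betw_finite[OF bij]
      by (simp add: card_cartesian_product)
  qed
qed

lemma card_subspaces_of_dim:
  fixes scale :: "'a::{field,finite} \<Rightarrow> 'v::ab_group_add \<Rightarrow> 'v"
  assumes fdvs: "finite_dimensional_vector_space scale Basis"
    and W: "module.subspace scale W"
  shows "real (card {U. module.subspace scale U \<and> U \<subseteq> W \<and> vector_space.dim scale U = k}) =
         gauss_binomial CARD('a) (vector_space.dim scale W) k"
proof -
  interpret finite_dimensional_vector_space scale Basis by (rule fdvs)
  note vs = vector_space_axioms
  define q where "q = CARD('a)"
  have "card {0, 1 :: 'a} \<le> CARD('a)" by (rule card_mono) auto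
  then have q: "q \<ge> 2" by (simp add: q_def)
  have card_sp: "card U = q ^ dim U" and fin_sp: "finite U" if U: "subspace U" for U
  proof -
    obtain B where B: "finite B" "B \<subseteq> U" "independent B" "span B = U" "card B = dim U"
      using basis_subspace_exists[OF U] by metis
    show "card U = q ^ dim U" "finite U"
      using card_span_independent[OF vs B(1,3)] B q_def by auto
  qed
  define L where "L U k = {xs. length xs = k \<and> distinct xs \<and> independent (set xs) \<and> set xs \<subseteq> U}"
    for U and k :: nat
  have L: "finite (L U k) \<and> real (card (L U k)) = (\<Prod>i<k. real q ^ dim U - real q ^ i)"
    if U: "subspace U" for U k
  proof (induction k)
    case 0
    have "L U 0 = {[]}" by (auto simp: L_def independent_empty)
    then show ?case by simp
  next
    case (Suc k)
    have "L U (Suc k) = (\<lambda>(xs, x). x # xs) ` (SIGMA xs : L U k. U - span (set xs))"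
    proof -
      have "ys \<in> L U (Suc k) \<longleftrightarrow> (\<exists>xs x. ys = x # xs \<and> xs \<in> L U k \<and> x \<in> U - span (set xs))" for ys
        by (cases ys) (auto simp: L_def independent_insert intro: span_base)
      then show ?thesis by (auto simp: image_iff Sigma_def)
    qed
    moreover have "inj_on (\<lambda>(xs, x). x # xs) (SIGMA xs : L U k. U - span (set xs))"
      by (auto simp: inj_on_def)
    ultimately have c: "card (L U (Suc k)) = card (SIGMA xs : L U k. U - span (set xs))"
      and f: "finite (L U (Suc k))"
      using Suc fin_sp[OF U] by (auto simp: card_image intro!: finite_SigmaI)
    have each: "real (card (U - span (set xs))) = real q ^ dim U - real q ^ k" if "xs \<in> L U k" for xs
    proof -
      have x: "distinct xs" "length xs = k" "independent (set xs)" "set xs \<subseteq> U"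
        using that by (auto simp: L_def)
      have sub: "span (set xs) \<subseteq> U" using x(4) U by (rule span_minimal)
      have "dim (span (set xs)) = k"
        using x distinct_card dim_span_eq_card_independent by metis
      then have "card (span (set xs)) = q ^ k" using card_sp[OF subspace_span] by metis
      moreover have "card (U - span (set xs)) = card U - card (span (set xs))"
        using sub fin_sp[OF subspace_span] by (intro card_Diff_subset) auto
      moreover have "card (span (set xs)) \<le> card U" using sub fin_sp[OF U] by (rule card_mono[rotated])
      ultimately show ?thesis using card_sp[OF U] by (simp add: of_nat_diff)
    qed
    have "real (card (SIGMA xs : L U k. U - span (set xs))) = (\<Sum>xs\<in>L U k. real (card (U - span (set xs))))"
      using Suc fin_sp[OF U] by (subst card_SigmaI) auto
    also have "\<dots> = real (card (L U k)) * (real q ^ dim U - real q ^ k)"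
      using each by simp
    finally show ?case using c f Suc by simp
  qed
  let ?S = "{U. subspace U \<and> U \<subseteq> W \<and> dim U = k}"
  have finS: "finite ?S" using fin_sp[OF W] by (auto intro: finite_subset[of _ "Pow W"])
  have "L W k = (\<Union>U\<in>?S. L U k)"
  proof (intro equalityI subsetI)
    fix xs assume x: "xs \<in> L W k"
    then have "dim (span (set xs)) = k"
      by (auto simp: L_def distinct_card dim_eq_card_independent)
    moreover have "span (set xs) \<subseteq> W" using x W by (intro span_minimal) (auto simp: L_def)
    moreover have "xs \<in> L (span (set xs)) k" using x by (auto simp: L_def span_base)
    ultimately show "xs \<in> (\<Union>U\<in>?S. L U k)" by blast
  qed (auto simp: L_def)
  moreover have "L U k \<inter> L U' k = {}" if "U \<in> ?S" "U' \<in> ?S" "U \<noteq> U'" for U U'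
  proof -
    have *: "span (set xs) = X" if "xs \<in> L X k" "X \<in> ?S" for xs X
    proof -
      have "X \<subseteq> span (set xs)"
        using that card_ge_dim_independent[of "set xs" X] distinct_card[of xs] by (auto simp: L_def)
      moreover have "span (set xs) \<subseteq> X" using that by (intro span_minimal) (auto simp: L_def)
      ultimately show ?thesis by auto
    qed
    then show ?thesis using that by blast
  qed
  ultimately have "card (L W k) = (\<Sum>U\<in>?S. card (L U k))"
    using finS L by (simp only:) (intro card_UN_disjoint, auto)
  then have "real (card (L W k)) = (\<Sum>U\<in>?S. real (card (L U k)))" by simp
  also have "\<dots> = (\<Sum>U\<in>?S. (\<Prod>i<k. real q ^ k - real q ^ i))"
    by (rule sum.cong) (use L in auto)
  finally have main: "(\<Prod>i<k. real q ^ dim W - real q ^ i) =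
      real (card ?S) * (\<Prod>i<k. real q ^ k - real q ^ i)"
    using L[OF W] by simp
  have "real q ^ i < real q ^ k" if "i < k" for i using q that by (intro power_strict_increasing) auto
  then have nz: "(\<Prod>i<k. real q ^ k - real q ^ i) \<noteq> 0" by (force simp: prod_zero_iff)
  have "real (card ?S) = (\<Prod>i<k. (real q ^ dim W - real q ^ i) / (real q ^ k - real q ^ i))"
    using main nz by (simp add: prod_dividef)
  also have "\<dots> = gauss_binomial q (dim W) k"
  proof (cases "k \<le> dim W")
    case True
    have split: "real q ^ n - real q ^ i = real q ^ i * (real q ^ (n - i) - 1)" if "i \<le> n" for n i
      using that by (simp add: algebra_simps flip: power_add)
    show ?thesis unfolding gauss_binomial_def
      by (rule prod.cong) (use True q in \<open>simp_all add: split\<close>)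
  next
    case False
    then have "(\<Prod>i<k. real q ^ dim W - real q ^ i) = 0"
      by (intro prod_zero) (auto intro!: bexI[of _ "dim W"])
    moreover have "(\<Prod>i<k. real q ^ (dim W - i) - 1) = 0"
      using False by (intro prod_zero) (auto intro!: bexI[of _ "dim W"])
    ultimately show ?thesis unfolding gauss_binomial_def prod_dividef by (simp only: div_0)
  qed
  finally show ?thesis by (simp add: q_def)
qed

end

theory Submission
  imports Defs "HOL-Computational_Algebra.Polynomial"
begin

text \<open>Counting pairs \<open>T \<subseteq> U\<close> with \<open>T\<close> a \<open>t\<close>-space through a fixed \<open>s\<close>-space \<open>S\<close> and \<open>U\<close> a block
  reduces the theorem to the number of \<open>t\<close>-spaces of the polar space through \<open>S\<close>; counting flags,
  only the case \<open>t = s + 1\<close> matters, i.e. the number of singular vectors in \<open>S\<^sup>\<bottom>\<close>. This number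
  is found without passing to the quotient \<open>S\<^sup>\<bottom>/S\<close>, by descent along a chain
  \<open>S \<subset> S' \<subset> \<dots> \<subset> M\<close> up to a maximal \<open>M\<close>, whose perp has no singular vectors outside \<open>M\<close>.
  The set \<open>S\<^sup>\<bottom> - S'\<^sup>\<bottom>\<close> is a union of affine lines in a direction \<open>y \<in> S' - S\<close>, each of which
  carries the same number \<open>w\<close> of singular vectors: \<open>q\<close>, \<open>\<surd>q\<close> or \<open>1\<close> for alternating, Hermitian
  and quadratic forms. The dimension of the ambient space enters only through
  \<open>w q\<^sup>n\<^sup>-\<^sup>r\<^sup>-\<^sup>1 = q\<^sup>r\<^sup>+\<^sup>\<epsilon>\<close>.\<close>

section \<open>Counting subspaces over a finite field\<close>

locale finite_field_vector_space = finite_dimensional_vector_space scale Basis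
  for scale :: "'a::{field,finite} \<Rightarrow> 'v::ab_group_add \<Rightarrow> 'v" and Basis +
  fixes q :: nat
  assumes q_card: "q = CARD('a)"
begin

lemma q_ge_2: "q \<ge> 2"
proof -
  have "card {0, 1 :: 'a} \<le> CARD('a)" by (rule card_mono) auto
  then show ?thesis by (simp add: q_card)
qed

lemma card_subspace:
  assumes "subspace U"
  shows "card U = q ^ dim U" and "finite U"
proof -
  obtain B where B: "finite B" "B \<subseteq> U" "independent B" "span B = U" "card B = dim U"
    using basis_subspace_exists[OF assms] by metis
  show "card U = q ^ dim U" "finite U"
    using card_span_independent[OF vector_space_axioms B(1,3)] B q_card by auto
qed

lemma finite_vectors [simp]: "finite (A :: 'v set)"
  by (rule finite_subset[OF subset_UNIV card_subspace(2)[OF subspace_UNIV]])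

lemma finite_families [simp]: "finite (A :: 'v set set)"
  by (rule finite_subset[of _ "Pow UNIV"], simp, simp only: finite_Pow_iff finite_vectors)

text \<open>Every \<open>x\<close> in \<open>A\<close> is uniquely a kernel vector plus a multiple
  of \<open>y\<close>, the coefficient being \<open>g x / g y\<close>.\<close>

lemma card_kernel:
  assumes A: "subspace A" and g: "Vector_Spaces.linear scale (*) g"
    and y: "y \<in> A" "g y \<noteq> 0"
  shows "q * card {x \<in> A. g x = 0} = card A"
proof -
  interpret g: Vector_Spaces.linear scale "(*)" g by (rule g)
  let ?h = "\<lambda>(c, x). x + scale c y"
  have "bij_betw ?h (UNIV \<times> {x \<in> A. g x = 0}) A"
  proof (rule bij_betw_byWitness[where f' = "\<lambda>x. (g x / g y, x - scale (g x / g y) y)"])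
    show "\<forall>a\<in>UNIV \<times> {x \<in> A. g x = 0}.
        (\<lambda>x. (g x / g y, x - scale (g x / g y) y)) (?h a) = a"
      using y by (auto simp: g.add g.scale)
    show "(\<lambda>x. (g x / g y, x - scale (g x / g y) y)) ` A \<subseteq> UNIV \<times> {x \<in> A. g x = 0}"
      using y A by (auto simp: g.diff g.scale intro!: subspace_diff subspace_scale)
  qed (use y A in \<open>auto intro!: subspace_add subspace_scale\<close>)
  from bij_betw_same_card[OF this] show ?thesis by (simp add: card_cartesian_product q_card)
qed

lemma dim_insert_notin:
  assumes "subspace S" "x \<notin> S"
  shows "dim (span (insert x S)) = Suc (dim S)"
  using assms by (simp add: dim_insert span_eq_iff[THEN iffD2])

section \<open>Covers and intervals in families of subspaces\<close>

text \<open>A cover \<open>T\<close> is spanned by \<open>S\<close> and any vector of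
  \<open>T - S\<close>, so these differences partition the vectors outside \<open>S\<close> whose
  adjunction stays in the family. The family is kept abstract to serve both the subspaces of a fixed
  \<open>W\<close> and the isotropic subspaces.\<close>

lemma card_covers:
  assumes sub: "\<And>U. U \<in> \<P> \<Longrightarrow> subspace U"
    and down: "\<And>U W. U \<in> \<P> \<Longrightarrow> subspace W \<Longrightarrow> W \<subseteq> U \<Longrightarrow> W \<in> \<P>"
    and S: "S \<in> \<P>"
  shows "real (card {T \<in> \<P>. S \<subseteq> T \<and> dim T = Suc (dim S)}) * (real q ^ dim S * (real q - 1)) =
    real (card {x. span (insert x S) \<in> \<P>}) - real q ^ dim S"
proof -
  let ?C = "{T \<in> \<P>. S \<subseteq> T \<and> dim T = Suc (dim S)}" and ?X = "{x. span (insert x S) \<in> \<P>}"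
  have sS: "subspace S" using sub[OF S] .
  have SX: "S \<subseteq> ?X"
    using S sS by (auto simp: insert_absorb span_eq_iff[THEN iffD2])
  have unique: "T = span (insert x S)" if "T \<in> ?C" "x \<in> T - S" for x T
  proof -
    have "span (insert x S) \<subseteq> T" using that sub by (intro span_minimal) auto
    then show ?thesis
      using that sub dim_insert_notin[OF sS, of x]
      by (intro subspace_dim_equal[symmetric]) auto
  qed
  have "?X - S = (\<Union>T\<in>?C. T - S)"
  proof (intro equalityI subsetI)
    fix x assume x: "x \<in> ?X - S"
    then have "span (insert x S) \<in> ?C" "x \<in> span (insert x S) - S"
      using dim_insert_notin[OF sS, of x] by (auto intro: span_base)
    then show "x \<in> (\<Union>T\<in>?C. T - S)" by blast
  next
    fix x assume "x \<in> (\<Union>T\<in>?C. T - S)"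
    then obtain T where "T \<in> ?C" "x \<in> T - S" by blast
    with unique[OF this] show "x \<in> ?X - S" by auto
  qed
  moreover have "card (\<Union>T\<in>?C. T - S) = (\<Sum>T\<in>?C. card (T - S))"
    by (rule card_UN_disjoint) (use unique in \<open>auto, blast+\<close>)
  moreover have "real (card (T - S)) = real q ^ dim S * (real q - 1)" if "T \<in> ?C" for T
  proof -
    have "real (card (T - S)) = real (card T) - real (card S)"
      using that by (simp add: card_Diff_subset of_nat_diff card_mono)
    then show ?thesis
      using that sub[of T] by (simp add: card_subspace sS algebra_simps)
  qed
  ultimately have "real (card (?X - S)) = real (card ?C) * (real q ^ dim S * (real q - 1))"
    by simp
  moreover have "real (card (?X - S)) = real (card ?X) - real (card S)"
    using SX by (simp add: card_Diff_subset of_nat_diff card_mono)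
  ultimately show ?thesis using card_subspace[OF sS] by simp
qed

lemma card_covers_interval:
  assumes "subspace S" "subspace W" "S \<subseteq> W"
  shows "real (card {T. subspace T \<and> T \<subseteq> W \<and> S \<subseteq> T \<and> dim T = Suc (dim S)}) =
    (real q ^ (dim W - dim S) - 1) / (real q - 1)"
proof -
  have "{x. subspace (span (insert x S)) \<and> span (insert x S) \<subseteq> W} = W"
    using assms by (auto intro: span_base span_minimal[THEN subsetD, of "insert _ S"])
  then have "real (card {T \<in> {U. subspace U \<and> U \<subseteq> W}. S \<subseteq> T \<and> dim T = Suc (dim S)}) *
      (real q ^ dim S * (real q - 1)) = real q ^ dim W - real q ^ dim S"
    using assms by (subst card_covers) (auto simp: card_subspace)
  also have "real q ^ dim W = real q ^ dim S * real q ^ (dim W - dim S)"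
    using dim_subset[OF assms(3)] by (simp flip: power_add)
  finally have "real q ^ dim S * (real (card {T. subspace T \<and> T \<subseteq> W \<and> S \<subseteq> T \<and>
      dim T = Suc (dim S)}) * (real q - 1)) =
      real q ^ dim S * (real q ^ (dim W - dim S) - 1)"
    by (simp add: algebra_simps conj_assoc)
  moreover have "real q ^ dim S \<noteq> 0" "real q - 1 \<noteq> 0" using q_ge_2 by auto
  ultimately show ?thesis using q_ge_2 by (simp add: eq_divide_eq)
qed

text \<open>Double counting of pairs \<open>R \<subseteq> T\<close> with \<open>R\<close> covering \<open>S\<close>, inductively in \<open>t - dim S\<close>;
  the product is a quotient of flag counts.\<close>

lemma card_above:
  assumes sub: "\<And>U. U \<in> \<P> \<Longrightarrow> subspace U"
    and down: "\<And>U W. U \<in> \<P> \<Longrightarrow> subspace W \<Longrightarrow> W \<subseteq> U \<Longrightarrow> W \<in> \<P>"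
    and covers: "\<And>S. S \<in> \<P> \<Longrightarrow> dim S < t \<Longrightarrow>
      real (card {T \<in> \<P>. S \<subseteq> T \<and> dim T = Suc (dim S)}) = c (dim S) / (real q - 1)"
    and "S \<in> \<P>" "dim S \<le> t"
  shows "real (card {T \<in> \<P>. S \<subseteq> T \<and> dim T = t}) =
    (\<Prod>i = dim S..<t. c i / (real q ^ (t - i) - 1))"
  using assms(4,5)
proof (induction "t - dim S" arbitrary: S)
  case 0
  then have "{T \<in> \<P>. S \<subseteq> T \<and> dim T = t} = {S}"
    using sub subspace_dim_equal by (auto, metis order_refl)
  then show ?case using 0 by simp
next
  case (Suc d)
  let ?s = "dim S"
  let ?C = "{R \<in> \<P>. S \<subseteq> R \<and> dim R = Suc ?s}" and ?N = "{T \<in> \<P>. S \<subseteq> T \<and> dim T = t}"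
  have st: "?s < t" using Suc by simp
  have pos: "real q ^ (t - ?s) > 1" "real q > 1"
    using q_ge_2 st by (auto intro: one_less_power)
  have "real (card {T \<in> ?N. R \<subseteq> T}) = (\<Prod>i = Suc ?s..<t. c i / (real q ^ (t - i) - 1))"
    if "R \<in> ?C" for R
  proof -
    have "{T \<in> ?N. R \<subseteq> T} = {T \<in> \<P>. R \<subseteq> T \<and> dim T = t}" using that by auto
    then show ?thesis using Suc.hyps(1)[of R] Suc.hyps(2) that by simp
  qed
  then have 1: "real (\<Sum>R\<in>?C. card {T \<in> ?N. R \<subseteq> T}) =
      c ?s / (real q - 1) * (\<Prod>i = Suc ?s..<t. c i / (real q ^ (t - i) - 1))"
    using covers[OF Suc.prems(1) st] by simp
  have 2: "(\<Sum>R\<in>?C. card {T \<in> ?N. R \<subseteq> T}) = (\<Sum>T\<in>?N. card {R \<in> ?C. R \<subseteq> T})"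
    by (rule sum_multicount_gen) auto
  have "real (card {R \<in> ?C. R \<subseteq> T}) = (real q ^ (t - ?s) - 1) / (real q - 1)"
    if "T \<in> ?N" for T
  proof -
    have "{R \<in> ?C. R \<subseteq> T} = {R. subspace R \<and> R \<subseteq> T \<and> S \<subseteq> R \<and> dim R = Suc ?s}"
      using that sub down by blast
    then show ?thesis using card_covers_interval[of S T] that sub Suc.prems by simp
  qed
  then have 3: "real (\<Sum>T\<in>?N. card {R \<in> ?C. R \<subseteq> T}) =
      real (card ?N) * ((real q ^ (t - ?s) - 1) / (real q - 1))"
    unfolding of_nat_sum by (subst sum.cong[OF refl]) auto
  have "real (card ?N) * ((real q ^ (t - ?s) - 1) / (real q - 1)) =
      c ?s / (real q - 1) * (\<Prod>i = Suc ?s..<t. c i / (real q ^ (t - i) - 1))"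
    using 1 unfolding 2 3 .
  then have "real (card ?N) = c ?s / (real q ^ (t - ?s) - 1) *
      (\<Prod>i = Suc ?s..<t. c i / (real q ^ (t - i) - 1))"
    using pos by (simp add: divide_simps)
  then show ?case using st by (simp add: prod.atLeast_Suc_lessThan)
qed

lemma gauss_binomial_shift:
  assumes "s \<le> t"
  shows "(\<Prod>i = s..<t. (real q ^ (m - i) - 1) / (real q ^ (t - i) - 1)) =
    gauss_binomial q (m - s) (t - s)"
  using prod.shift_bounds_nat_ivl[of "\<lambda>i. (real q ^ (m - i) - 1) / (real q ^ (t - i) - 1)"
      0 s "t - s"] assms
  by (simp add: gauss_binomial_def atLeast0LessThan add.commute)

lemma gauss_binomial_pos:
  assumes "k \<le> m"
  shows "gauss_binomial q m k > 0"
proof -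
  have "real q ^ n > 1" if "n > 0" for n
    using q_ge_2 that by (intro one_less_power) auto
  then show ?thesis
    unfolding gauss_binomial_def using assms by (intro prod_pos ballI divide_pos_pos) auto
qed

lemma card_interval:
  assumes "subspace S" "subspace W" "S \<subseteq> W" "dim S \<le> t"
  shows "real (card {T. subspace T \<and> T \<subseteq> W \<and> S \<subseteq> T \<and> dim T = t}) =
    gauss_binomial q (dim W - dim S) (t - dim S)"
proof -
  have "real (card {T \<in> {U. subspace U \<and> U \<subseteq> W}. S \<subseteq> T \<and> dim T = t}) =
      (\<Prod>i = dim S..<t. (real q ^ (dim W - i) - 1) / (real q ^ (t - i) - 1))"
    using assms card_covers_interval[OF _ assms(2)]
    by (intro card_above) (auto simp: conj_assoc)
  then show ?thesis using gauss_binomial_shift[OF assms(4)] by (simp add: conj_assoc)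
qed

end

section \<open>Polar spaces\<close>

text \<open>\<open>Z\<close> is the set of singular vectors. Alternating, Hermitian and quadratic forms differ only
  in the number \<open>w\<close> of singular vectors on an affine line \<open>x + \<langle>y\<rangle>\<close> with singular direction
  \<open>y\<close> not orthogonal to \<open>x\<close>.\<close>

locale polar_form = finite_field_vector_space scale Basis q
  for scale :: "'a::{field,finite} \<Rightarrow> 'v::ab_group_add \<Rightarrow> 'v" and Basis q +
  fixes B :: "'v \<Rightarrow> 'v \<Rightarrow> 'a" and Z :: "'v set" and w :: nat
  assumes B_linear: "Vector_Spaces.linear scale (*) (\<lambda>x. B x y)"
    and B_sym: "B x y = 0 \<Longrightarrow> B y x = 0"
    and Z_self: "x \<in> Z \<Longrightarrow> B x x = 0"
    and Z_zero: "0 \<in> Z"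
    and Z_scale: "x \<in> Z \<Longrightarrow> scale c x \<in> Z"
    and Z_add: "x \<in> Z \<Longrightarrow> y \<in> Z \<Longrightarrow> B x y = 0 \<Longrightarrow> x + y \<in> Z"
    and Z_nondegenerate: "y \<in> Z \<Longrightarrow> (\<And>x. B x y = 0) \<Longrightarrow> y = 0"
    and card_Z_line: "y \<in> Z \<Longrightarrow> B x y \<noteq> 0 \<Longrightarrow> card {c. x + scale c y \<in> Z} = w"
begin

definition isotropics :: "'v set set" where
  "isotropics = {U. subspace U \<and> U \<subseteq> Z \<and> (\<forall>x\<in>U. \<forall>y\<in>U. B x y = 0)}"

text \<open>\<open>B\<close> is assumed linear only in its first argument, since a Hermitian form
  need not be linear in the second. Collecting first arguments makes the perp a subspace.\<close>

definition perp :: "'v set \<Rightarrow> 'v set" where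
  "perp A = {x. \<forall>y\<in>A. B x y = 0}"

definition rank :: nat where
  "rank = Max (dim ` isotropics)"

section \<open>Orthogonality and perps\<close>

lemma B_simps [simp]:
  "B 0 y = 0" "B (x + x') y = B x y + B x' y" "B (x - x') y = B x y - B x' y"
  "B (scale c x) y = c * B x y"
proof -
  interpret b: Vector_Spaces.linear scale "(*)" "\<lambda>x. B x y" by (rule B_linear)
  show "B 0 y = 0" "B (x + x') y = B x y + B x' y" "B (x - x') y = B x y - B x' y"
    "B (scale c x) y = c * B x y"
    by (rule b.zero b.add b.diff b.scale)+
qed

lemma subspace_perp: "subspace (perp A)"
  by (auto simp: perp_def subspace_def)

lemma subset_perp_commute: "A \<subseteq> perp C \<longleftrightarrow> C \<subseteq> perp A"
  using B_sym by (auto simp: perp_def subset_iff)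

text \<open>The span is moved into the linear first argument by the symmetry of orthogonality:
  \<open>perp (perp A)\<close> is a subspace containing \<open>A\<close>.\<close>

lemma perp_span: "perp (span A) = perp A"
proof
  have "span A \<subseteq> perp (perp A)"
    using subspace_perp subset_perp_commute by (intro span_minimal) auto
  then show "perp A \<subseteq> perp (span A)" using subset_perp_commute by blast
qed (auto simp: perp_def span_base)

lemma isotropicsD:
  assumes "U \<in> isotropics"
  shows "subspace U" "U \<subseteq> Z" "U \<subseteq> perp U"
  using assms by (auto simp: isotropics_def perp_def)

lemma isotropics_downward:
  "U \<in> isotropics \<Longrightarrow> subspace W \<Longrightarrow> W \<subseteq> U \<Longrightarrow> W \<in> isotropics"
  by (auto simp: isotropics_def subset_iff)

lemma zero_isotropic: "{0} \<in> isotropics"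
  using Z_zero by (simp add: isotropics_def)

text \<open>Turns the extension vectors of \<open>card_covers\<close> into the singular vectors of a
  perp.\<close>

lemma span_insert_isotropic_iff:
  assumes "S \<in> isotropics"
  shows "span (insert x S) \<in> isotropics \<longleftrightarrow> x \<in> perp S \<inter> Z"
proof
  assume "span (insert x S) \<in> isotropics"
  from isotropicsD[OF this] show "x \<in> perp S \<inter> Z"
    by (auto simp: perp_def span_base subset_iff)
next
  assume x: "x \<in> perp S \<inter> Z"
  note S = isotropicsD[OF assms]
  have "insert x S \<subseteq> perp (insert x S)"
    using x S(3) Z_self B_sym by (auto simp: perp_def)
  then have "span (insert x S) \<subseteq> perp (span (insert x S))"
    unfolding perp_span by (intro span_minimal subspace_perp)
  moreover have "span (insert x S) \<subseteq> Z"
  proof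
    fix u assume "u \<in> span (insert x S)"
    then obtain c where c: "u - scale c x \<in> S"
      using span_breakdown_eq S(1) span_eq_iff by metis
    have "scale c x + (u - scale c x) \<in> Z"
      using x c S(2) by (intro Z_add Z_scale) (auto simp: perp_def)
    then show "u \<in> Z" by simp
  qed
  ultimately show "span (insert x S) \<in> isotropics"
    by (auto simp: isotropics_def perp_def)
qed

text \<open>Both sides arise from counting the orthogonal pairs in \<open>A \<times> C\<close>. With \<open>A = UNIV\<close> this gives
  the size of a perp, and with \<open>A\<close> maximal isotropic it shows that every isotropic subspace
  extends to one of maximal dimension.\<close>

lemma perp_duality:
  assumes A: "subspace A" and C: "subspace C"
  shows "card (A \<inter> perp C) * card C = card (C \<inter> perp A) * card A"
proof -
  have count: "q * (\<Sum>x\<in>A. card {y \<in> C. B y x = 0}) =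
      card A * card C + card (A \<inter> perp C) * ((q - 1) * card C)"
    if C: "subspace C" for A C
  proof -
    \<comment> \<open>By \<open>card_kernel\<close>, an \<open>x\<close> outside
      \<open>perp C\<close> is orthogonal to one \<open>q\<close>-th of \<open>C\<close>, and any
      other \<open>x\<close> to all of \<open>C\<close>. The factor \<open>q\<close> keeps the count
      in the naturals.\<close>
    have "q * card {y \<in> C. B y x = 0} = card C + (if x \<in> perp C then (q - 1) * card C else 0)"
      for x
    proof (cases "x \<in> perp C")
      case True
      then have "{y \<in> C. B y x = 0} = C" using B_sym by (auto simp: perp_def)
      then show ?thesis using True q_ge_2 by (simp add: algebra_simps)
    next
      case False
      then obtain y where "y \<in> C" "B y x \<noteq> 0" using B_sym by (auto simp: perp_def)
      then show ?thesis using card_kernel[OF C B_linear] False by simp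
    qed
    then have "q * (\<Sum>x\<in>A. card {y \<in> C. B y x = 0}) =
        (\<Sum>x\<in>A. card C + (if x \<in> perp C then (q - 1) * card C else 0))"
      by (simp add: sum_distrib_left)
    also have "\<dots> = card A * card C + card (A \<inter> perp C) * ((q - 1) * card C)"
      by (simp add: sum.distrib flip: sum.inter_restrict)
    finally show ?thesis .
  qed
  have "(\<Sum>x\<in>A. card {y \<in> C. B y x = 0}) = (\<Sum>y\<in>C. card {x \<in> A. B y x = 0})"
    by (rule sum_multicount_gen) auto
  also have "\<dots> = (\<Sum>y\<in>C. card {x \<in> A. B x y = 0})"
    by (intro sum.cong refl arg_cong[where f = card]) (use B_sym in blast)
  finally have "card A * card C + card (A \<inter> perp C) * ((q - 1) * card C) =
      card C * card A + card (C \<inter> perp A) * ((q - 1) * card A)"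
    using count[OF C, of A] count[OF A, of C] by presburger
  then have "(q - 1) * (card (A \<inter> perp C) * card C) = (q - 1) * (card (C \<inter> perp A) * card A)"
    by (simp add: algebra_simps)
  moreover have "q - 1 \<noteq> 0" using q_ge_2 by simp
  ultimately show ?thesis by (metis mult_left_cancel)
qed

text \<open>This is \<open>perp_duality\<close> against the whole space. Nondegeneracy is assumed
  for singular vectors only, and \<open>S \<subseteq> Z\<close> lets it show that \<open>S\<close>
  meets the radical trivially.\<close>

lemma card_perp:
  assumes "S \<in> isotropics"
  shows "card (perp S) * q ^ dim S = q ^ dim (UNIV :: 'v set)"
proof -
  note S = isotropicsD[OF assms]
  have "S \<inter> perp UNIV = {0}"
    using Z_nondegenerate B_sym S subspace_0[OF S(1)] by (auto simp: perp_def)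
  then show ?thesis
    using perp_duality[OF subspace_UNIV S(1)] card_subspace(1)[OF S(1)]
      card_subspace(1)[OF subspace_UNIV] by simp
qed

lemma dim_le_rank: "S \<in> isotropics \<Longrightarrow> dim S \<le> rank"
  by (simp add: rank_def)

lemma obtain_rank:
  obtains M where "M \<in> isotropics" "dim M = rank"
proof -
  have "rank \<in> dim ` isotropics"
    unfolding rank_def using zero_isotropic by (intro Max_in) auto
  then show ?thesis using that by auto
qed

text \<open>Let \<open>M\<close> have dimension \<open>rank\<close>. Since
  \<open>M \<subseteq> perp M\<close> and \<open>dim S < dim M\<close>, \<open>perp_duality\<close>
  makes \<open>M \<inter> perp S\<close> larger than \<open>S \<inter> M\<close>, and any vector in
  the difference works.\<close>

lemma isotropic_extend:
  assumes "S \<in> isotropics" "dim S < rank"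
  obtains y where "y \<in> perp S \<inter> Z - S"
proof -
  obtain M where M: "M \<in> isotropics" "dim M = rank" by (rule obtain_rank)
  note SD = isotropicsD[OF assms(1)] and MD = isotropicsD[OF M(1)]
  have "0 \<in> S \<inter> M" using SD(1) MD(1) by (simp add: subspace_0)
  then have pos: "card (S \<inter> M) > 0" by (auto simp: card_gt_0_iff)
  have "card (S \<inter> M) * q ^ dim S < card (S \<inter> M) * q ^ rank"
    using pos assms(2) q_ge_2 by (intro mult_strict_left_mono power_strict_increasing) auto
  also have "\<dots> \<le> card (S \<inter> perp M) * q ^ rank"
    using MD(3) by (intro mult_right_mono card_mono) auto
  also have "\<dots> = card (M \<inter> perp S) * q ^ dim S"
    using perp_duality[OF MD(1) SD(1)] M(2) card_subspace(1)[OF SD(1)] card_subspace(1)[OF MD(1)]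
    by simp
  finally have "card (S \<inter> M) < card (M \<inter> perp S)" by simp
  then have "\<not> M \<inter> perp S \<subseteq> S \<inter> M" using card_mono[of "S \<inter> M" "M \<inter> perp S"] by auto
  then show ?thesis using that MD(2) by blast
qed

section \<open>Singular vectors in the perp of an isotropic subspace\<close>

text \<open>Pairs \<open>(x, c)\<close> with \<open>x\<close> in the difference of the two perps and
  \<open>x + scale c y\<close> singular are counted twice. Each \<open>x\<close> admits
  \<open>w\<close> scalars. Each \<open>c\<close> admits as many \<open>x\<close> as the difference
  has singular vectors, because the difference is stable under translation by multiples of
  \<open>y\<close>.\<close>

lemma card_singular_perp_step:
  assumes S: "S \<in> isotropics" and y: "y \<in> perp S \<inter> Z - S"
  shows "q * card (perp S \<inter> Z) =
    q * card (perp (span (insert y S)) \<inter> Z) + w * card (perp S - perp (span (insert y S)))"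
proof -
  define X where "X = perp S - perp (span (insert y S))"
  have X: "X = {x \<in> perp S. B x y \<noteq> 0}"
    unfolding X_def perp_span by (auto simp: perp_def)
  have shift: "x + scale c y \<in> X \<longleftrightarrow> x \<in> X" for x c
  proof -
    have "B y z = 0" if "z \<in> insert y S" for z using that y Z_self by (auto simp: perp_def)
    then show ?thesis by (auto simp: X perp_def)
  qed
  have fibre: "card {x \<in> X. x + scale c y \<in> Z} = card (X \<inter> Z)" for c
  proof (rule bij_betw_same_card)
    show "bij_betw (\<lambda>x. x + scale c y) {x \<in> X. x + scale c y \<in> Z} (X \<inter> Z)"
      by (rule bij_betw_byWitness[where f' = "\<lambda>x. x - scale c y"])
        (use shift in \<open>auto, metis diff_add_cancel\<close>)
  qed
  have "w * card X = (\<Sum>x\<in>X. card {c. x + scale c y \<in> Z})"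
    using card_Z_line y by (simp add: X)
  also have "\<dots> = (\<Sum>c\<in>UNIV. card {x \<in> X. x + scale c y \<in> Z})"
    using sum_multicount_gen[of X "UNIV :: 'a set" "\<lambda>x c. x + scale c y \<in> Z"] by simp
  also have "\<dots> = q * card (X \<inter> Z)" by (simp add: fibre q_card)
  finally have "w * card X = q * card (X \<inter> Z)" .
  moreover have "card (perp S \<inter> Z) = card (perp (span (insert y S)) \<inter> Z) + card (X \<inter> Z)"
  proof -
    have "perp S \<inter> Z = (perp (span (insert y S)) \<inter> Z) \<union> (X \<inter> Z)"
      unfolding X_def perp_span by (auto simp: perp_def)
    moreover have "(perp (span (insert y S)) \<inter> Z) \<inter> (X \<inter> Z) = {}" by (auto simp: X_def)
    ultimately show ?thesis by (simp add: card_Un_disjoint)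
  qed
  ultimately show ?thesis by (simp add: X_def algebra_simps)
qed

text \<open>By the preceding step, \<open>card (perp S \<inter> Z) - w / q * card (perp S)\<close>
  is unchanged when \<open>S\<close> is enlarged. It therefore equals its value at dimension
  \<open>rank\<close>, where \<open>perp S \<inter> Z = S\<close>; the subtracted quotient is the
  size of the perp there.\<close>

lemma card_singular_perp:
  assumes "S \<in> isotropics"
  shows "real (card (perp S \<inter> Z)) = real q ^ rank +
    w / q * (real (card (perp S)) - real q ^ dim (UNIV :: 'v set) / real q ^ rank)"
  using assms
proof (induction "rank - dim S" arbitrary: S)
  case 0
  then have r: "dim S = rank" using dim_le_rank[of S] by simp
  note S = isotropicsD[OF 0(2)]
  have "perp S \<inter> Z = S"
  proof (rule ccontr)
    assume "perp S \<inter> Z \<noteq> S"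
    then obtain y where "y \<in> perp S \<inter> Z" "y \<notin> S" using S by blast
    then have "span (insert y S) \<in> isotropics" "dim (span (insert y S)) = Suc rank"
      using span_insert_isotropic_iff[OF 0(2)] dim_insert_notin[OF S(1)] r by auto
    then show False using dim_le_rank by fastforce
  qed
  moreover have "real (card (perp S)) = real q ^ dim (UNIV :: 'v set) / real q ^ rank"
    using arg_cong[OF card_perp[OF 0(2)], of real] q_ge_2 r by (simp add: field_simps)
  ultimately show ?case using card_subspace(1)[OF S(1)] r by simp
next
  case (Suc d)
  then have lt: "dim S < rank" by simp
  obtain y where y: "y \<in> perp S \<inter> Z - S" using isotropic_extend[OF Suc.prems lt] .
  let ?T = "span (insert y S)"
  have T: "?T \<in> isotropics" using span_insert_isotropic_iff[OF Suc.prems] y by blast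
  have "dim ?T = Suc (dim S)" using dim_insert_notin isotropicsD(1)[OF Suc.prems] y by blast
  then have IH: "real (card (perp ?T \<inter> Z)) = real q ^ rank +
    w / q * (real (card (perp ?T)) - real q ^ dim (UNIV :: 'v set) / real q ^ rank)"
    using Suc.hyps T by (intro Suc.hyps(1)) auto
  have "perp ?T \<subseteq> perp S" unfolding perp_span by (auto simp: perp_def)
  then have "real (card (perp S - perp ?T)) = real (card (perp S)) - real (card (perp ?T))"
    by (simp add: card_Diff_subset of_nat_diff card_mono)
  then have "real q * real (card (perp S \<inter> Z)) = real q * real (card (perp ?T \<inter> Z)) +
      real w * (real (card (perp S)) - real (card (perp ?T)))"
    using arg_cong[OF card_singular_perp_step[OF Suc.prems y], of real] by simp
  then have "real (card (perp S \<inter> Z)) = real (card (perp ?T \<inter> Z)) +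
      w / q * (real (card (perp S)) - real (card (perp ?T)))"
    using q_ge_2 by (simp add: field_simps)
  then show ?case unfolding IH by (simp add: algebra_simps)
qed

section \<open>Isotropic subspaces through a given one\<close>

text \<open>With \<open>m = rank - dim S\<close>, this is the point count of a polar space of rank
  \<open>m\<close> with parameter \<open>\<epsilon>\<close>. Once \<open>q ^ dim S\<close> is
  factored out, it rests on \<open>q^m + q^(m+\<epsilon>) (q^m - 1) - 1 = (q^m - 1)
  (q^(m+\<epsilon>) + 1)\<close>.\<close>

lemma card_covers_isotropic:
  assumes S: "S \<in> isotropics"
    and w: "w / q * (real q ^ dim (UNIV :: 'v set) / real q ^ rank) = real q powr (real rank + \<epsilon>)"
  shows "real (card {T \<in> isotropics. S \<subseteq> T \<and> dim T = Suc (dim S)}) =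
    (real q ^ (rank - dim S) - 1) * (real q powr (real (rank - dim S) + \<epsilon>) + 1) / (real q - 1)"
proof -
  let ?m = "rank - dim S" and ?n = "dim (UNIV :: 'v set)"
  have q: "real q > 1" using q_ge_2 by simp
  have sr: "dim S \<le> rank" using dim_le_rank[OF S] .
  have split: "real q ^ rank = real q ^ dim S * real q ^ ?m"
    using sr by (simp flip: power_add)
  have p: "real (card (perp S)) = real q ^ ?n / real q ^ rank * real q ^ ?m"
    using arg_cong[OF card_perp[OF S], of real] q unfolding split by (simp add: field_simps)
  have powr: "real q powr (real rank + \<epsilon>) = real q ^ dim S * real q powr (real ?m + \<epsilon>)"
    using q sr by (simp add: of_nat_diff flip: powr_realpow powr_add)
  have "real (card (perp S \<inter> Z)) = real q ^ rank +
      w / q * (real q ^ ?n / real q ^ rank) * (real q ^ ?m - 1)"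
    unfolding card_singular_perp[OF S] p
    by (simp only: right_diff_distrib mult.assoc mult_1_right)
  also have "\<dots> = real q ^ dim S *
      (real q ^ ?m + real q powr (real ?m + \<epsilon>) * (real q ^ ?m - 1))"
    unfolding w unfolding powr split by (simp add: algebra_simps)
  finally have z: "real (card (perp S \<inter> Z)) = \<dots>" .
  have "real (card {T \<in> isotropics. S \<subseteq> T \<and> dim T = Suc (dim S)}) *
      (real q ^ dim S * (real q - 1)) =
      real (card {x. span (insert x S) \<in> isotropics}) - real q ^ dim S"
    by (rule card_covers) (fact isotropicsD(1) isotropics_downward S)+
  also have "{x. span (insert x S) \<in> isotropics} = perp S \<inter> Z"
    using span_insert_isotropic_iff[OF S] by blast
  finally have "real q ^ dim S * (real (card {T \<in> isotropics. S \<subseteq> T \<and> dim T = Suc (dim S)}) *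
      (real q - 1)) =
      real q ^ dim S * ((real q ^ ?m - 1) * (real q powr (real ?m + \<epsilon>) + 1))"
    unfolding z by (simp add: algebra_simps)
  then show ?thesis using q by (simp add: eq_divide_eq)
qed

lemma card_isotropic_above:
  assumes S: "S \<in> isotropics" and t: "dim S \<le> t" "t \<le> rank"
    and w: "w / q * (real q ^ dim (UNIV :: 'v set) / real q ^ rank) =
      real q powr (real rank + polar_eps Q)"
  shows "real (card {T \<in> isotropics. S \<subseteq> T \<and> dim T = t}) =
    polar_binomial Q q (rank - dim S) (t - dim S)"
proof -
  let ?s = "dim S"
  let ?p = "\<lambda>i. real q powr (real i + polar_eps Q) + 1"
  have "real (card {T \<in> isotropics. S \<subseteq> T \<and> dim T = t}) =
      (\<Prod>i = ?s..<t. (real q ^ (rank - i) - 1) * ?p (rank - i) / (real q ^ (t - i) - 1))"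
    by (rule card_above; (fact isotropicsD(1) isotropics_downward S t(1)
        | erule card_covers_isotropic[OF _ w]))
  also have "\<dots> = (\<Prod>i = ?s..<t. (real q ^ (rank - i) - 1) / (real q ^ (t - i) - 1)) *
      (\<Prod>i = ?s..<t. ?p (rank - i))"
    by (simp flip: prod.distrib)
  also have "(\<Prod>i = ?s..<t. (real q ^ (rank - i) - 1) / (real q ^ (t - i) - 1)) =
      gauss_binomial q (rank - ?s) (t - ?s)"
    using t by (intro gauss_binomial_shift) auto
  \<comment> \<open>As \<open>i\<close> runs through \<open>?s..<t\<close>, \<open>rank - i\<close>
    runs from \<open>rank - t + 1\<close> to \<open>rank - ?s\<close>; the lower limit is written in
    the shape found in \<open>polar_binomial\<close>.\<close>
  also have "(\<Prod>i = ?s..<t. ?p (rank - i)) =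
      (\<Prod>i = rank - ?s - (t - ?s) + 1..rank - ?s. ?p i)"
    by (rule prod.reindex_bij_witness[where i = "\<lambda>i. rank - i" and j = "\<lambda>i. rank - i"])
      (use t in auto)
  finally show ?thesis by (simp add: polar_binomial_def)
qed

text \<open>In the count of pairs \<open>T \<subseteq> U\<close> above \<open>S\<close> both inner
  counts are constant: \<open>l\<close> by the design property, and a Gaussian binomial by
  \<open>card_interval\<close>. The latter is positive because \<open>t \<le> k\<close>, which
  permits the division.\<close>

lemma card_blocks_above:
  assumes D: "D \<subseteq> {U \<in> isotropics. dim U = k}"
    and l: "\<And>T. T \<in> isotropics \<Longrightarrow> dim T = t \<Longrightarrow> card {U \<in> D. T \<subseteq> U} = l"
    and tk: "t \<le> k" "k \<le> rank"
    and w: "w / q * (real q ^ dim (UNIV :: 'v set) / real q ^ rank) =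
      real q powr (real rank + polar_eps Q)"
    and S: "S \<in> isotropics" "dim S \<le> t"
  shows "real (card {U \<in> D. S \<subseteq> U}) =
    real l * (polar_binomial Q q (rank - dim S) (t - dim S) / gauss_binomial q (k - dim S) (t - dim S))"
proof -
  let ?T = "{T \<in> isotropics. S \<subseteq> T \<and> dim T = t}" and ?D = "{U \<in> D. S \<subseteq> U}"
  let ?g = "gauss_binomial q (k - dim S) (t - dim S)"
  have "(\<Sum>T\<in>?T. card {U \<in> ?D. T \<subseteq> U}) = (\<Sum>U\<in>?D. card {T \<in> ?T. T \<subseteq> U})"
    by (rule sum_multicount_gen) auto
  moreover have "card {U \<in> ?D. T \<subseteq> U} = l" if "T \<in> ?T" for T
  proof -
    have "{U \<in> ?D. T \<subseteq> U} = {U \<in> D. T \<subseteq> U}" using that by auto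
    then show ?thesis using l that by simp
  qed
  moreover have g: "real (card {T \<in> ?T. T \<subseteq> U}) = ?g" if "U \<in> ?D" for U
  proof -
    have U: "U \<in> isotropics" "dim U = k" "S \<subseteq> U" using that D by auto
    have "{T \<in> ?T. T \<subseteq> U} = {T. subspace T \<and> T \<subseteq> U \<and> S \<subseteq> T \<and> dim T = t}"
      using isotropics_downward[OF U(1)] isotropicsD(1) by blast
    then show ?thesis
      using card_interval[of S U t] isotropicsD(1)[OF S(1)] isotropicsD(1)[OF U(1)] U S(2) by simp
  qed
  then have "real (\<Sum>U\<in>?D. card {T \<in> ?T. T \<subseteq> U}) = real (card ?D) * ?g"
    unfolding of_nat_sum by (subst sum.cong[OF refl g]) auto
  ultimately have "real l * real (card ?T) = real (card ?D) * ?g"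
    by (simp add: mult.commute flip: of_nat_mult)
  moreover have "real (card ?T) = polar_binomial Q q (rank - dim S) (t - dim S)"
    using S tk w by (intro card_isotropic_above) auto
  moreover have "?g > 0" using tk S by (intro gauss_binomial_pos) auto
  ultimately show ?thesis by (simp add: field_simps)
qed

end

section \<open>The three kinds of forms\<close>

text \<open>The map \<open>c \<mapsto> (a + c b)\<^sup>p + c b\<close> takes values among the at most \<open>p\<close> roots of \<open>v\<^sup>p = v\<close>, and its
  fibres have at most \<open>p\<close> elements. As there are \<open>p\<^sup>2\<close> arguments, every fibre has exactly \<open>p\<close>
  elements.\<close>

lemma card_hermitian_line:
  fixes a b :: "'a::{field,finite}"
  assumes p: "CARD('a) = p\<^sup>2" and b: "b \<noteq> 0" and a: "a ^ p = a"
    and fixed: "\<And>c. ((a + c * b) ^ p + c * b) ^ p = (a + c * b) ^ p + c * b"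
  shows "card {c. (a + c * b) ^ p + c * b = 0} = p"
proof -
  have "card {0, 1 :: 'a} \<le> CARD('a)" by (rule card_mono) auto
  then have p2: "p \<ge> 2" using p by (cases "p \<le> 1") (auto simp: le_Suc_eq)
  define A where "A = {v :: 'a. v ^ p = v}"
  define \<phi> where "\<phi> c = (a + c * b) ^ p + c * b" for c
  \<comment> \<open>One root bound serves twice: \<open>e = - 1\<close>, \<open>v = 0\<close> bounds
    \<open>A\<close>, and the substitution \<open>u = a + c * b\<close> turns
    \<open>\<phi> c = v\<close> into \<open>u ^ p + 1 * u = a + v\<close>, which bounds the
    fibres.\<close>
  have roots: "card {u :: 'a. u ^ p + e * u = v} \<le> p" for e v
  proof -
    let ?f = "monom 1 p + [:- v, e:]"
    have deg: "degree ?f = p"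
      using p2 by (subst degree_add_eq_left) (auto simp: degree_monom_eq)
    then have "?f \<noteq> 0" using p2 by auto
    from card_poly_roots_bound[OF this]
    have "card {u. poly ?f u = 0} \<le> p" using deg by simp
    moreover have "{u. poly ?f u = 0} = {u. u ^ p + e * u = v}"
      by (auto simp: poly_monom algebra_simps)
    ultimately show ?thesis by simp
  qed
  have A: "card A \<le> p" using roots[of "- 1" 0] by (simp add: A_def)
  have fibre: "card {c. \<phi> c = v} \<le> p" for v
  proof -
    have "inj_on (\<lambda>c. a + c * b) {c. \<phi> c = v}" using b by (auto simp: inj_on_def)
    moreover have "(\<lambda>c. a + c * b) ` {c. \<phi> c = v} \<subseteq> {u. u ^ p + 1 * u = a + v}"
      by (auto simp: \<phi>_def algebra_simps)
    ultimately have "card {c. \<phi> c = v} \<le> card {u :: 'a. u ^ p + 1 * u = a + v}"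
      by (intro card_inj_on_le[where f = "\<lambda>c. a + c * b"]) auto
    then show ?thesis using roots[of 1 "a + v"] by simp
  qed
  have 0: "0 \<in> A" using p2 by (simp add: A_def)
  have "p\<^sup>2 = card (\<Union>v\<in>A. {c. \<phi> c = v})"
  proof -
    have "(\<Union>v\<in>A. {c. \<phi> c = v}) = UNIV" using fixed by (auto simp: A_def \<phi>_def)
    then show ?thesis using p by simp
  qed
  also have "\<dots> = (\<Sum>v\<in>A. card {c. \<phi> c = v})"
    by (rule card_UN_disjoint) auto
  also have "\<dots> = card {c. \<phi> c = 0} + (\<Sum>v\<in>A - {0}. card {c. \<phi> c = v})"
    using 0 by (subst sum.remove[of _ 0]) auto
  also have "\<dots> \<le> card {c. \<phi> c = 0} + (p - 1) * p"
    using sum_bounded_above[of "A - {0}" "\<lambda>v. card {c. \<phi> c = v}" p] fibre A 0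
    by (auto intro!: add_left_mono elim!: order_trans simp: mult_le_mono1)
  finally have "p \<le> card {c. \<phi> c = 0}"
    using p2 by (cases p) (auto simp: power2_eq_square algebra_simps)
  then show ?thesis using fibre[of 0] by (simp add: \<phi>_def)
qed

text \<open>Every vector is singular, so all \<open>q\<close> scalars count on each line.\<close>

lemma polar_form_alternating:
  fixes scale :: "'a::{field,finite} \<Rightarrow> 'v::ab_group_add \<Rightarrow> 'v"
  assumes "finite_dimensional_vector_space scale Basis"
    and alt: "alternating_form scale B" and nd: "nondegenerate B"
  shows "polar_form scale Basis CARD('a) B UNIV CARD('a)"
proof -
  interpret finite_field_vector_space scale Basis "CARD('a)"
    by (intro finite_field_vector_space.intro finite_field_vector_space_axioms.intro assms(1) refl)
  have l: "Vector_Spaces.linear scale (*) (\<lambda>x. B x y)"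
    and r: "Vector_Spaces.linear scale (*) (B x)" and z: "B x x = 0" for x y
    using alt by (auto simp: alternating_form_def bilinear_form_def)
  interpret l: Vector_Spaces.linear scale "(*)" "\<lambda>x. B x y" for y by (rule l)
  interpret r: Vector_Spaces.linear scale "(*)" "B x" for x by (rule r)
  have skew: "B y x = - B x y" for x y
    using z[of "x + y"] z[of x] z[of y] by (simp add: l.add r.add add_eq_0_iff)
  show ?thesis
  proof unfold_locales
    fix x y
    show "B x y = 0 \<Longrightarrow> B y x = 0" using skew[of x y] by simp
    assume "\<And>x. B x y = 0"
    then have "B y x = 0" for x using skew[of x y] by simp
    then show "y = 0" using nd by (simp add: nondegenerate_def)
  qed (simp_all add: l z)
qed

lemma polar_form_hermitian:
  fixes scale :: "'a::{field,finite} \<Rightarrow> 'v::ab_group_add \<Rightarrow> 'v"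
  assumes "finite_dimensional_vector_space scale Basis"
    and herm: "hermitian_form scale B" and nd: "nondegenerate B"
  obtains p where "CARD('a) = p\<^sup>2" "polar_form scale Basis CARD('a) B {x. B x x = 0} p"
proof -
  interpret finite_field_vector_space scale Basis "CARD('a)"
    by (intro finite_field_vector_space.intro finite_field_vector_space_axioms.intro assms(1) refl)
  obtain p where p: "CARD('a) = p\<^sup>2" and l: "\<And>y. Vector_Spaces.linear scale (*) (\<lambda>x. B x y)"
    and conj: "\<And>x y. B y x = B x y ^ p"
    using herm unfolding hermitian_form_def by blast
  interpret l: Vector_Spaces.linear scale "(*)" "\<lambda>x. B x y" for y by (rule l)
  have p0: "p > 0" using q_ge_2 p by (cases p) auto
  have sym: "B y x = 0" if "B x y = 0" for x y
    using conj[of y x] that p0 by (simp add: power_0_left)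
  \<comment> \<open>Conjugation moves the sum into the linear first argument; the
    \<open>p\<close>-th power of the sum is left unexpanded, the shape used in
    \<open>card_hermitian_line\<close>.\<close>
  have right: "B x (y + z) = (B y x + B z x) ^ p" for x y z
    using conj[of x "y + z"] by (simp add: l.add)
  have line: "card {c. B (x + scale c y) (x + scale c y) = 0} = p"
    if y: "B y y = 0" and xy: "B x y \<noteq> 0" for x y
  proof -
    let ?a = "B x x" and ?b = "B y x"
    have b: "?b \<noteq> 0" using sym xy by blast
    have "B y (x + scale c y) = (B x y) ^ p" for c
      unfolding right by (simp add: l.scale y)
    then have "B y (x + scale c y) = ?b" for c
      using conj[of y x] by simp
    then have e: "B (x + scale c y) (x + scale c y) = (?a + c * ?b) ^ p + c * ?b" for c
      by (simp only: l.add l.scale right[of x])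
    have self: "B u u ^ p = B u u" for u using conj[of u u] by (rule HOL.sym)
    \<comment> \<open>The expression is the value \<open>B u u\<close> at
      \<open>u = x + scale c y\<close>, hence fixed by the \<open>p\<close>-th power.\<close>
    have "((?a + c * ?b) ^ p + c * ?b) ^ p = (?a + c * ?b) ^ p + c * ?b" for c
      using self[of "x + scale c y"] unfolding e .
    with p b self[of x] show ?thesis unfolding e by (rule card_hermitian_line)
  qed
  have "polar_form scale Basis CARD('a) B {x. B x x = 0} p"
  proof unfold_locales
    fix x y c
    show "scale c x \<in> {x. B x x = 0}" if "x \<in> {x. B x x = 0}"
      using that sym[of "scale c x" x] by (simp add: l.scale)
    show "x + y \<in> {x. B x x = 0}"
      if "x \<in> {x. B x x = 0}" "y \<in> {x. B x x = 0}" "B x y = 0"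
      using that sym[of x y] p0 by (simp add: l.add right power_0_left)
    show "y = 0" if "\<And>x. B x y = 0"
      using nd sym[OF that] by (simp add: nondegenerate_def)
  qed (use line in \<open>simp_all add: l sym l.zero\<close>)
  with p show ?thesis by (rule that)
qed

text \<open>Along a singular direction \<open>y\<close> the form is affine,
  \<open>f (x + scale c y) = f x + c * polarization f x y\<close>, so it has exactly one zero when
  the slope is nonzero.\<close>

lemma polar_form_quadratic:
  fixes scale :: "'a::{field,finite} \<Rightarrow> 'v::ab_group_add \<Rightarrow> 'v"
  assumes "finite_dimensional_vector_space scale Basis"
    and quad: "quadratic_form scale f" and ns: "nonsingular f"
  shows "polar_form scale Basis CARD('a) (polarization f) {x. f x = 0} 1"
proof -
  interpret finite_field_vector_space scale Basis "CARD('a)"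
    by (intro finite_field_vector_space.intro finite_field_vector_space_axioms.intro assms(1) refl)
  let ?B = "polarization f"
  have l: "Vector_Spaces.linear scale (*) (\<lambda>x. ?B x y)"
    and r: "Vector_Spaces.linear scale (*) (?B x)" and sq: "f (scale c x) = c\<^sup>2 * f x" for x y c
    using quad by (auto simp: quadratic_form_def bilinear_form_def)
  interpret l: Vector_Spaces.linear scale "(*)" "\<lambda>x. ?B x y" for y by (rule l)
  interpret r: Vector_Spaces.linear scale "(*)" "?B x" for x by (rule r)
  have add: "f (x + y) = f x + f y + ?B x y" for x y by (simp add: polarization_def)
  have sym: "?B x y = ?B y x" for x y by (simp add: polarization_def add.commute)
  have zero: "f 0 = 0" using sq[of 0 0] by simp
  have self: "?B x x = 0" if "f x = 0" for x
    using sq[of 2 x] scale_left_distrib[of 1 1 x] that by (simp add: polarization_def)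
  have line: "card {c. f (x + scale c y) = 0} = 1" if "f y = 0" "?B x y \<noteq> 0" for x y
  proof -
    have "{c. f (x + scale c y) = 0} = {- f x / ?B x y}"
      using that by (auto simp: add sq r.scale field_simps add_eq_0_iff)
    then show ?thesis by simp
  qed
  show ?thesis
  proof unfold_locales
    fix x y
    show "?B y x = 0" if "?B x y = 0" using that sym[of x y] by simp
    show "y = 0" if "y \<in> {x. f x = 0}" "\<And>x. ?B x y = 0"
      using that ns sym[of y] by (simp add: nonsingular_def)
  qed (use line in \<open>simp_all add: l zero self sq add\<close>)
qed

section \<open>From types to the numerical parameters, and the theorem\<close>

text \<open>The six types reduce to three cases with ambient dimension
  \<open>2 r + \<epsilon> + d\<close> and \<open>w = q^(1-d)\<close>, where \<open>d\<close> is 0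
  for alternating, 1/2 for Hermitian and 1 for quadratic forms. The two occurrences of
  \<open>d\<close> cancel in the last identity.\<close>

lemma polar_space_form:
  fixes scale :: "'a::{field,finite} \<Rightarrow> 'v::ab_group_add \<Rightarrow> 'v"
  assumes fd: "finite_dimensional_vector_space scale Basis"
    and q: "q = CARD('a)" and ps: "polar_space scale Q r P"
  obtains B Z w where "polar_form scale Basis q B Z w"
    and "P = {U. module.subspace scale U \<and> U \<subseteq> Z \<and> (\<forall>x\<in>U. \<forall>y\<in>U. B x y = 0)}"
    and "w / q * (real q ^ vector_space.dim scale (UNIV :: 'v set) / real q ^ r) =
      real q powr (real r + polar_eps Q)"
proof -
  note result = that
  interpret finite_field_vector_space scale Basis q
    by (intro finite_field_vector_space.intro finite_field_vector_space_axioms.intro fd q)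
  have dim: "dim (UNIV :: 'v set) = ambient_dim Q r" using ps by (simp add: polar_space_def)
  have q0: "real q > 0" using q_ge_2 by simp
  have powr: "real q ^ m / real q ^ r = real q powr (real m - real r)" for m
    using q0 by (simp add: powr_diff powr_realpow)
  have quadratic: thesis
    if "quadratic_form scale f" "nonsingular f" "P = singular_subspaces scale f"
      "real (ambient_dim Q r) = 2 * real r + polar_eps Q + 1" for f
  proof (rule result)
    show "polar_form scale Basis q (polarization f) {x. f x = 0} 1"
      using polar_form_quadratic[OF fd] that q by simp
    show "P = {U. subspace U \<and> U \<subseteq> {x. f x = 0} \<and> (\<forall>x\<in>U. \<forall>y\<in>U. polarization f x y = 0)}"
      unfolding that(3) singular_subspaces_def polarization_def
      by (auto simp: subspace_add subset_iff)
    show "real 1 / q * (real q ^ dim (UNIV :: 'v set) / real q ^ r) =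
        real q powr (real r + polar_eps Q)"
      unfolding dim powr that(4) using q0 by (simp add: algebra_simps powr_add powr_diff)
  qed
  have hermitian: thesis
    if B: "hermitian_form scale B" "nondegenerate B" and PB: "P = isotropic_subspaces scale B"
      and amb: "real (ambient_dim Q r) = 2 * real r + polar_eps Q + 1 / 2" for B
  proof -
    obtain p where p: "CARD('a) = p\<^sup>2" "polar_form scale Basis CARD('a) B {x. B x x = 0} p"
      using polar_form_hermitian[OF fd B] .
    have "p = real q powr (1 / 2)" using p(1) q q0 by (simp add: powr_half_sqrt)
    then have "p / q * (real q ^ dim (UNIV :: 'v set) / real q ^ r) =
        real q powr (1 / 2) / real q powr 1 * real q powr (real r + polar_eps Q + 1 / 2)"
      unfolding dim powr amb using q0 by (simp add: algebra_simps)
    also have "\<dots> = real q powr (real r + polar_eps Q)"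
      by (simp only: flip: powr_add powr_diff) simp
    finally show ?thesis
      using p(2) PB q
      by (intro result[of B "{x. B x x = 0}" p]) (auto simp: isotropic_subspaces_def)
  qed
  have symplectic: thesis
    if "alternating_form scale B" "nondegenerate B" "P = isotropic_subspaces scale B"
      "real (ambient_dim Q r) = 2 * real r + polar_eps Q" for B
  proof (rule result)
    show "polar_form scale Basis q B UNIV q"
      using polar_form_alternating[OF fd] that q by simp
    show "real q / q * (real q ^ dim (UNIV :: 'v set) / real q ^ r) =
        real q powr (real r + polar_eps Q)"
      unfolding dim powr that(4) using q0 by (simp add: algebra_simps)
  qed (auto simp: that(3) isotropic_subspaces_def)
  show thesis
    using ps quadratic hermitian symplectic
    by (cases Q) (auto simp: polar_space_def)
qed

theorem lemma5:
  fixes scale :: "'a::{field,finite} \<Rightarrow> 'v::ab_group_add \<Rightarrow> 'v"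
    and Basis :: "'v set"
    and Q :: polar_type
    and P D :: "'v set set"
    and r t k l q :: nat
  assumes "finite_dimensional_vector_space scale Basis"
    and "q = CARD('a)"
    and "polar_space scale Q r P"
    and "1 \<le> r"
    and "t \<le> k" and "k \<le> r"
    and "polar_design scale P t r k l D"
  shows "\<exists>L :: nat \<Rightarrow> nat.
    (\<forall>s\<le>t. polar_design scale P s r k (L s) D \<and>
       real (L s) = real l * (polar_binomial Q q (r - s) (t - s) / gauss_binomial q (k - s) (t - s)) \<and>
       real (L s) = real l * (gauss_binomial q (r - s) (t - s) / gauss_binomial q (k - s) (t - s)) *
         (\<Prod>i = r - t + 1..r - s. real q powr (real i + polar_eps Q) + 1)) \<and>
    card D = L 0"
proof -
  obtain B Z w where form: "polar_form scale Basis q B Z w"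
    and P: "P = {U. module.subspace scale U \<and> U \<subseteq> Z \<and> (\<forall>x\<in>U. \<forall>y\<in>U. B x y = 0)}"
    and w: "w / q * (real q ^ vector_space.dim scale (UNIV :: 'v set) / real q ^ r) =
      real q powr (real r + polar_eps Q)"
    using polar_space_form[OF assms(1-3)] .
  interpret polar_form scale Basis q B Z w by (rule form)
  have iso: "P = isotropics" unfolding P isotropics_def ..
  have rank: "rank = r"
    using assms(3) by (simp add: polar_space_def polar_rank_def rank_def iso)
  note design = assms(7)[unfolded polar_design_def iso]
  define b where "b s = real l * (polar_binomial Q q (r - s) (t - s) / gauss_binomial q (k - s) (t - s))"
    for s
  have blocks: "real (card {U \<in> D. S \<subseteq> U}) = b (dim S)" if "S \<in> isotropics" "dim S \<le> t" for S
    using card_blocks_above[of D k t l Q S] design assms(5,6) w that unfolding rank b_def by simp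
  \<comment> \<open>The formula \<open>b s\<close> is a real number, while a design needs a natural
    one.\<close>
  define L where "L s = nat \<lfloor>b s\<rfloor>" for s
  have L: "card {U \<in> D. S \<subseteq> U} = L (dim S)" if "S \<in> isotropics" "dim S \<le> t" for S
    using blocks[OF that] unfolding L_def by (metis floor_of_nat nat_int)
  \<comment> \<open>That the floor loses nothing is seen from an actual block count, so an isotropic
    subspace of dimension \<open>s\<close> is needed; it is cut out of one of dimension
    \<open>rank\<close>.\<close>
  have Lb: "real (L s) = b s" if s: "s \<le> t" for s
  proof -
    obtain M where M: "M \<in> isotropics" "dim M = rank" by (rule obtain_rank)
    obtain S where "subspace S" "S \<subseteq> M" "dim S = s"
      using M s assms(5,6) rank isotropicsD(1)[OF M(1)]
      by (metis choose_subspace_of_subspace le_trans span_eq_iff)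
    then have "S \<in> isotropics" "dim S \<le> t" using isotropics_downward[OF M(1)] s by auto
    then show ?thesis using blocks L \<open>dim S = s\<close> by metis
  qed
  have "polar_design scale P s r k (L s) D \<and> real (L s) = b s \<and>
      real (L s) = real l * (gauss_binomial q (r - s) (t - s) / gauss_binomial q (k - s) (t - s)) *
        (\<Prod>i = r - t + 1..r - s. real q powr (real i + polar_eps Q) + 1)" if s: "s \<le> t" for s
  proof (intro conjI)
    show "polar_design scale P s r k (L s) D"
      using design s L unfolding polar_design_def iso by auto
    show "real (L s) = b s" using Lb[OF s] .
    have "r - s - (t - s) = r - t" using s assms(5,6) by simp
    then show "real (L s) =
        real l * (gauss_binomial q (r - s) (t - s) / gauss_binomial q (k - s) (t - s)) *
        (\<Prod>i = r - t + 1..r - s. real q powr (real i + polar_eps Q) + 1)"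
      unfolding Lb[OF s] b_def polar_binomial_def by simp
  qed
  moreover have "card D = L 0"
  proof -
    \<comment> \<open>Every block contains the zero subspace, so the count for \<open>s = 0\<close>
      covers all of \<open>D\<close>.\<close>
    have "D = {U \<in> D. {0} \<subseteq> U}"
      using design isotropicsD(1) by (auto simp: subspace_0)
    then show ?thesis using L[OF zero_isotropic] by simp
  qed
  ultimately show ?thesis unfolding b_def by blast
qed

end
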